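(* Let $\mathbb{K}$ be a field of characteristic not $2$ and let $(\mathcal{A},\bullet,\alpha)$ be a multiplicative Hom-associative affgebra over $\mathbb{K}$. For every $o\in\mathcal{A}$ with $\alpha(o)=o$, the fibre space $T_o\mathcal{A}$ together with the unary map $\overrightarrow{\alpha}_o(a)=\alpha(a)$ and the multiplication $$a\bullet_o b=\langle a\bullet b,\;a\bullet o,\;o\bullet o,\;o\bullet b,\;o\rangle = a\bullet b-a\bullet o+o\bullet o-o\bullet b+o,\qquad a,b\in T_o\mathcal{A}$$ (sums and differences taken in $T_o\mathcal{A}$), is a Hom-associative algebra. Furthermore, for any $o,e\in\mathcal{A}$ with $\alpha(o)=o$ and $\alpha(e)=e$, the Hom-associative algebras $(T_o\mathcal{A},\bullet_o,\alpha)$ and $(T_e\mathcal{A},\bullet_e,\alpha)$ are isomorphic.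
   Context: An abelian heap is a set $\mathcal{A}$ with a ternary operation $\langle-,-,-\rangle$ satisfying $\langle\langle a,b,c\rangle,d,e\rangle=\langle a,b,\langle c,d,e\rangle\rangle$, $\langle a,a,b\rangle=b=\langle b,a,a\rangle$ and $\langle a,b,c\rangle=\langle c,b,a\rangle$; $\langle a_1,\dots,a_{2n+1}\rangle$ denotes any iterated application of the operation (the result does not depend on bracketing). An affine space over $\mathbb{K}$ is a non-empty abelian heap $\mathcal{A}$ with an action $\mathbb{K}\times\mathcal{A}\times\mathcal{A}\to\mathcal{A}$, $(\xi,a,b)\mapsto\xi\blacktriangleright_a b$, such that: $\xi\blacktriangleright_a-$ and $-\blacktriangleright_a b$ are heap homomorphisms ($\mathbb{K}$ being a heap via $\xi-\zeta+\gamma$); $(\xi\zeta)\blacktriangleright_a b=\xi\blacktriangleright_a(\zeta\blacktriangleright_a b)$; $\xi\blacktriangleright_a b=\langle\xi\blacktriangleright_c b,\xi\blacktriangleright_c a,a\rangle$; $0\blacktriangleright_a b=a$, $1\blacktriangleright_a b=b$. An affine map is a heap homomorphism $f$ with $f(\xi\blacktriangleright_a b)=\xi\blacktriangleright_{f(a)}f(b)$. A map $\mathcal{A}\times\mathcal{A}\to\mathcal{A}$ is bi-affine if it is affine in each argument. For $o\in\mathcal{A}$, the fibre $T_o\mathcal{A}$ is the vector space with underlying set $\mathcal{A}$, addition $a+b=\langle a,o,b\rangle$, scalar multiplication $\xi a=\xi\blacktriangleright_o a$, and zero $o$. A Hom-associative affgebra is a triple $(\mathcal{A},\bullet,\alpha)$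 with $\mathcal{A}$ an affine space, $\bullet:\mathcal{A}\times\mathcal{A}\to\mathcal{A}$ bi-affine, $\alpha:\mathcal{A}\to\mathcal{A}$ affine, such that $\alpha(a)\bullet(b\bullet c)=(a\bullet b)\bullet\alpha(c)$ for all $a,b,c$. It is multiplicative if $\alpha(a\bullet b)=\alpha(a)\bullet\alpha(b)$. A Hom-associative algebra is a vector space with a bilinear product $\cdot$ and a linear map $\alpha$ such that $\alpha(a)\cdot(b\cdot c)=(a\cdot b)\cdot\alpha(c)$. An isomorphism of such is a linear bijection preserving products and intertwining the twisting maps. *)

theory Defs
  imports "HOL-Algebra.Module"
begin

section \<open>Abelian heaps\<close>

record 'a heap = "'a partial_object" +
  tern :: "'a \<Rightarrow> 'a \<Rightarrow> 'a \<Rightarrow> 'a"  (\<open>\<langle>_,_,_\<rangle>\<index>\<close>)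

locale abelian_heap =
  fixes H :: "('a, 'z) heap_scheme" (structure)
  assumes tern_closed:
      "\<lbrakk>a \<in> carrier H; b \<in> carrier H; c \<in> carrier H\<rbrakk> \<Longrightarrow> \<langle>a,b,c\<rangle> \<in> carrier H"
    and tern_assoc:
      "\<lbrakk>a \<in> carrier H; b \<in> carrier H; c \<in> carrier H; d \<in> carrier H; e \<in> carrier H\<rbrakk>
        \<Longrightarrow> \<langle>\<langle>a,b,c\<rangle>,d,e\<rangle> = \<langle>a,b,\<langle>c,d,e\<rangle>\<rangle>"
    and tern_left_cancel: "\<lbrakk>a \<in> carrier H; b \<in> carrier H\<rbrakk> \<Longrightarrow> \<langle>a,a,b\<rangle> = b"
    and tern_right_cancel: "\<lbrakk>a \<in> carrier H; b \<in> carrier H\<rbrakk> \<Longrightarrow> \<langle>b,a,a\<rangle> = b"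
    and tern_commute:
      "\<lbrakk>a \<in> carrier H; b \<in> carrier H; c \<in> carrier H\<rbrakk> \<Longrightarrow> \<langle>a,b,c\<rangle> = \<langle>c,b,a\<rangle>"

definition heap_hom :: "('a, 'y) heap_scheme \<Rightarrow> ('b, 'z) heap_scheme \<Rightarrow> ('a \<Rightarrow> 'b) set"
  where "heap_hom G H =
    {f \<in> carrier G \<rightarrow> carrier H.
      \<forall>a\<in>carrier G. \<forall>b\<in>carrier G. \<forall>c\<in>carrier G. f \<langle>a,b,c\<rangle>\<^bsub>G\<^esub> = \<langle>f a, f b, f c\<rangle>\<^bsub>H\<^esub>}"

definition ring_heap :: "('k, 'z) ring_scheme \<Rightarrow> 'k heap"
  where "ring_heap K =
    \<lparr>carrier = carrier K, tern = (\<lambda>\<xi> \<zeta> \<gamma>. (\<xi> \<ominus>\<^bsub>K\<^esub> \<zeta>) \<oplus>\<^bsub>K\<^esub> \<gamma>)\<rparr>"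

text \<open>One bracketing of the five-fold iterated heap operation; by associativity all agree.\<close>

definition tern5 :: "('a, 'z) heap_scheme \<Rightarrow> 'a \<Rightarrow> 'a \<Rightarrow> 'a \<Rightarrow> 'a \<Rightarrow> 'a \<Rightarrow> 'a"
  where "tern5 H a b c d e = \<langle>\<langle>a,b,c\<rangle>\<^bsub>H\<^esub>, d, e\<rangle>\<^bsub>H\<^esub>"


section \<open>Affine spaces\<close>

text \<open>\<open>act A \<xi> a b\<close> is the action of the scalar \<open>\<xi>\<close> on the point \<open>b\<close> with base point \<open>a\<close>.\<close>

record ('k, 'a) affine = "'a heap" +
  act :: "'k \<Rightarrow> 'a \<Rightarrow> 'a \<Rightarrow> 'a"

locale affine_space = field K + abelian_heap A
  for K :: "('k, 'y) ring_scheme" and A :: "('k, 'a, 'z) affine_scheme" +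
  assumes nonempty: "carrier A \<noteq> {}"
    and act_hom_point:
      "\<lbrakk>\<xi> \<in> carrier K; a \<in> carrier A\<rbrakk> \<Longrightarrow> (\<lambda>b. act A \<xi> a b) \<in> heap_hom A A"
    and act_hom_scalar:
      "\<lbrakk>a \<in> carrier A; b \<in> carrier A\<rbrakk> \<Longrightarrow> (\<lambda>\<xi>. act A \<xi> a b) \<in> heap_hom (ring_heap K) A"
    and act_mult:
      "\<lbrakk>\<xi> \<in> carrier K; \<zeta> \<in> carrier K; a \<in> carrier A; b \<in> carrier A\<rbrakk>
        \<Longrightarrow> act A (\<xi> \<otimes>\<^bsub>K\<^esub> \<zeta>) a b = act A \<xi> a (act A \<zeta> a b)"
    and act_base_change:
      "\<lbrakk>\<xi> \<in> carrier K; a \<in> carrier A; b \<in> carrier A; c \<in> carrier A\<rbrakk>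
        \<Longrightarrow> act A \<xi> a b = \<langle>act A \<xi> c b, act A \<xi> c a, a\<rangle>\<^bsub>A\<^esub>"
    and act_zero: "\<lbrakk>a \<in> carrier A; b \<in> carrier A\<rbrakk> \<Longrightarrow> act A \<zero>\<^bsub>K\<^esub> a b = a"
    and act_one: "\<lbrakk>a \<in> carrier A; b \<in> carrier A\<rbrakk> \<Longrightarrow> act A \<one>\<^bsub>K\<^esub> a b = b"

definition affine_map ::
    "('k, 'y) ring_scheme \<Rightarrow> ('k, 'a, 'w) affine_scheme \<Rightarrow> ('k, 'b, 'z) affine_scheme \<Rightarrow> ('a \<Rightarrow> 'b) set"
  where "affine_map K A B =
    {f \<in> heap_hom A B.
      \<forall>\<xi>\<in>carrier K. \<forall>a\<in>carrier A. \<forall>b\<in>carrier A. f (act A \<xi> a b) = act B \<xi> (f a) (f b)}"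

definition bi_affine ::
    "('k, 'y) ring_scheme \<Rightarrow> ('k, 'a, 'z) affine_scheme \<Rightarrow> ('a \<Rightarrow> 'a \<Rightarrow> 'a) \<Rightarrow> bool"
  where "bi_affine K A m \<longleftrightarrow>
    (\<forall>a\<in>carrier A. (\<lambda>b. m a b) \<in> affine_map K A A) \<and>
    (\<forall>b\<in>carrier A. (\<lambda>a. m a b) \<in> affine_map K A A)"

text \<open>
  The fibre at \<open>p\<close> as a module record. The fields \<open>mult\<close> and \<open>one\<close> come with the record type
  and play no role for a vector space, so they are left unspecified.
\<close>

definition fibre :: "('k, 'a, 'z) affine_scheme \<Rightarrow> 'a \<Rightarrow> ('k, 'a) module"
  where "fibre A p =
    \<lparr>carrier = carrier A, mult = undefined, one = undefined,
     zero = p, add = (\<lambda>a b. \<langle>a,p,b\<rangle>\<^bsub>A\<^esub>), smult = (\<lambda>\<xi> a. act A \<xi> p a)\<rparr>"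


section \<open>Hom-associative affgebras\<close>

locale hom_assoc_affgebra = affine_space K A
  for K :: "('k, 'y) ring_scheme" and A :: "('k, 'a, 'z) affine_scheme"
    and m :: "'a \<Rightarrow> 'a \<Rightarrow> 'a" and \<alpha> :: "'a \<Rightarrow> 'a" +
  assumes mult_bi_affine: "bi_affine K A m"
    and twist_affine: "\<alpha> \<in> affine_map K A A"
    and hom_assoc:
      "\<lbrakk>a \<in> carrier A; b \<in> carrier A; c \<in> carrier A\<rbrakk> \<Longrightarrow> m (\<alpha> a) (m b c) = m (m a b) (\<alpha> c)"

locale multiplicative_hom_assoc_affgebra = hom_assoc_affgebra +
  assumes twist_mult:
      "\<lbrakk>a \<in> carrier A; b \<in> carrier A\<rbrakk> \<Longrightarrow> \<alpha> (m a b) = m (\<alpha> a) (\<alpha> b)"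

definition fibre_mult ::
    "('k, 'a, 'z) affine_scheme \<Rightarrow> ('a \<Rightarrow> 'a \<Rightarrow> 'a) \<Rightarrow> 'a \<Rightarrow> 'a \<Rightarrow> 'a \<Rightarrow> 'a"
  where "fibre_mult A m p a b = tern5 A (m a b) (m a p) (m p p) (m p b) p"


section \<open>Hom-associative algebras\<close>

definition linear_map ::
    "('k, 'y) ring_scheme \<Rightarrow> ('k, 'v, 'w) module_scheme \<Rightarrow> ('k, 'u, 'z) module_scheme \<Rightarrow> ('v \<Rightarrow> 'u) set"
  where "linear_map K V W =
    {f \<in> carrier V \<rightarrow> carrier W.
      (\<forall>x\<in>carrier V. \<forall>y\<in>carrier V. f (x \<oplus>\<^bsub>V\<^esub> y) = f x \<oplus>\<^bsub>W\<^esub> f y) \<and>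
      (\<forall>\<xi>\<in>carrier K. \<forall>x\<in>carrier V. f (\<xi> \<odot>\<^bsub>V\<^esub> x) = \<xi> \<odot>\<^bsub>W\<^esub> f x)}"

definition bilinear_product ::
    "('k, 'y) ring_scheme \<Rightarrow> ('k, 'v, 'z) module_scheme \<Rightarrow> ('v \<Rightarrow> 'v \<Rightarrow> 'v) \<Rightarrow> bool"
  where "bilinear_product K V m \<longleftrightarrow>
    (\<forall>x\<in>carrier V. (\<lambda>y. m x y) \<in> linear_map K V V) \<and>
    (\<forall>y\<in>carrier V. (\<lambda>x. m x y) \<in> linear_map K V V)"

locale hom_assoc_algebra = field K + module K V
  for K :: "('k, 'y) ring_scheme" and V :: "('k, 'v, 'z) module_scheme"
    and m :: "'v \<Rightarrow> 'v \<Rightarrow> 'v" and \<alpha> :: "'v \<Rightarrow> 'v" +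
  assumes product_bilinear: "bilinear_product K V m"
    and twist_linear: "\<alpha> \<in> linear_map K V V"
    and hom_assoc:
      "\<lbrakk>x \<in> carrier V; y \<in> carrier V; z \<in> carrier V\<rbrakk> \<Longrightarrow> m (\<alpha> x) (m y z) = m (m x y) (\<alpha> z)"

definition hom_assoc_algebra_iso ::
    "('k, 'y) ring_scheme \<Rightarrow>
     ('k, 'v, 'w) module_scheme \<Rightarrow> ('v \<Rightarrow> 'v \<Rightarrow> 'v) \<Rightarrow> ('v \<Rightarrow> 'v) \<Rightarrow>
     ('k, 'u, 'z) module_scheme \<Rightarrow> ('u \<Rightarrow> 'u \<Rightarrow> 'u) \<Rightarrow> ('u \<Rightarrow> 'u) \<Rightarrow> ('v \<Rightarrow> 'u) set"
  where "hom_assoc_algebra_iso K V m \<alpha> W n \<beta> =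
    {f \<in> linear_map K V W.
      bij_betw f (carrier V) (carrier W) \<and>
      (\<forall>x\<in>carrier V. \<forall>y\<in>carrier V. f (m x y) = n (f x) (f y)) \<and>
      (\<forall>x\<in>carrier V. f (\<alpha> x) = \<beta> (f x))}"


section \<open>Characteristic\<close>

text \<open>
  HOL-Algebra has no characteristic for carrier-based rings; this mirrors \<open>CHAR\<close> of the type
  class hierarchy.
\<close>

definition ring_characteristic :: "('k, 'y) ring_scheme \<Rightarrow> nat"
  where "ring_characteristic K =
    (if \<exists>n>0. add_pow K (n::nat) \<one>\<^bsub>K\<^esub> = \<zero>\<^bsub>K\<^esub>
     then LEAST n. n > 0 \<and> add_pow K n \<one>\<^bsub>K\<^esub> = \<zero>\<^bsub>K\<^esub> else 0)"

end

theory Submission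
  imports Defs
begin

text \<open>
  Over a point \<open>p\<close>, a bi-affine product splits as the sum of a bilinear map, two linear maps and a
  constant, and \<open>\<bullet>\<^sub>p\<close> is its bilinear part. The left-hand and the right-hand side of the
  Hom-associative law are affine in each of the three variables; comparing their trilinear parts
  yields the Hom-associative law for \<open>\<bullet>\<^sub>p\<close>, where \<open>\<alpha> p = p\<close> makes \<open>\<alpha>\<close> its own
  linear part. The bilinear part of a bi-affine map does not depend on the base point once the fibres
  are identified by a translation, so the translation from \<open>p\<close> to \<open>e\<close> is an isomorphism of algebras;
  it commutes with \<open>\<alpha>\<close> because both points are fixed.

  The computations stay inside the heap. They rest on two facts. First, a pointwise heap combination of
  affine maps is affine (\<open>affine_map_tern\<close>), and an affine map taking \<open>p\<close> to \<open>q\<close> is linear between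
  the fibres (\<open>affine_map_linear\<close>); hence \<open>\<bullet>\<^sub>p\<close> is bilinear and translations are linear.
  Second, the bilinear part is reached in two steps: the linear part of \<open>z \<mapsto> w \<bullet> z\<close>, written
  \<open>left_linear_part\<close>, and then the linear part of that in \<open>w\<close> (\<open>fibre_mult_eq\<close>). The first step turns
  the Hom-associative law into an identity between linear parts in \<open>z\<close>
  (\<open>left_linear_part_hom_assoc\<close>); taking linear parts of it in \<open>x\<close> and in \<open>y\<close> gives the law for
  \<open>\<bullet>\<^sub>p\<close>.
\<close>

section \<open>Rearranging iterated heap operations\<close>

context abelian_heap
begin

text \<open>
  Writing \<open>x\<close> as \<open>\<langle>\<langle>x,b,c\<rangle>,d,\<langle>d,c,b\<rangle>\<rangle>\<close> makes the compound middle entry cancel.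
\<close>

lemma tern_middle:
  assumes [simp]: "x \<in> carrier H" "b \<in> carrier H" "c \<in> carrier H" "d \<in> carrier H" "y \<in> carrier H"
  shows "\<langle>x,\<langle>d,c,b\<rangle>,y\<rangle> = \<langle>\<langle>x,b,c\<rangle>,d,y\<rangle>"
proof -
  have "x = \<langle>\<langle>\<langle>x,b,c\<rangle>,d,d\<rangle>,c,b\<rangle>"
    by (simp add: tern_closed tern_right_cancel tern_assoc tern_left_cancel)
  also have "\<dots> = \<langle>\<langle>x,b,c\<rangle>,d,\<langle>d,c,b\<rangle>\<rangle>"
    by (rule tern_assoc) (simp_all add: tern_closed)
  finally have x: "x = \<langle>\<langle>x,b,c\<rangle>,d,\<langle>d,c,b\<rangle>\<rangle>" .
  have "\<langle>x,\<langle>d,c,b\<rangle>,y\<rangle> = \<langle>\<langle>\<langle>x,b,c\<rangle>,d,\<langle>d,c,b\<rangle>\<rangle>,\<langle>d,c,b\<rangle>,y\<rangle>"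
    by (subst x) (rule refl)
  also have "\<dots> = \<langle>\<langle>x,b,c\<rangle>,d,\<langle>\<langle>d,c,b\<rangle>,\<langle>d,c,b\<rangle>,y\<rangle>\<rangle>"
    by (rule tern_assoc) (simp_all add: tern_closed)
  finally show ?thesis by (simp add: tern_closed tern_left_cancel)
qed

lemma tern_swap_even:
  assumes "x \<in> carrier H" "b \<in> carrier H" "c \<in> carrier H" "d \<in> carrier H" "y \<in> carrier H"
  shows "\<langle>\<langle>x,b,c\<rangle>,d,y\<rangle> = \<langle>\<langle>x,d,c\<rangle>,b,y\<rangle>"
  using assms by (metis tern_middle tern_commute)

lemma tern_swap_odd:
  assumes "x \<in> carrier H" "b \<in> carrier H" "c \<in> carrier H" "d \<in> carrier H" "y \<in> carrier H"
  shows "\<langle>\<langle>x,b,c\<rangle>,d,y\<rangle> = \<langle>\<langle>x,b,y\<rangle>,d,c\<rangle>"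
  using assms by (metis tern_assoc tern_commute)

text \<open>
  Written with the brackets to the left, both sides are words of length nine with the same entries in
  the odd places and the same entries in the even places; the two swaps sort such words.
\<close>

lemma tern_medial:
  assumes [simp]: "a \<in> carrier H" "b \<in> carrier H" "c \<in> carrier H"
    "d \<in> carrier H" "e \<in> carrier H" "f \<in> carrier H"
    "g \<in> carrier H" "h \<in> carrier H" "i \<in> carrier H"
  shows "\<langle>\<langle>a,b,c\<rangle>,\<langle>d,e,f\<rangle>,\<langle>g,h,i\<rangle>\<rangle> = \<langle>\<langle>a,d,g\<rangle>,\<langle>b,e,h\<rangle>,\<langle>c,f,i\<rangle>\<rangle>"
  by (simp add: tern_closed tern_middle tern_assoc [symmetric]
      tern_swap_even tern_swap_odd)

end


section \<open>Affine maps and fibres\<close>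

context affine_space
begin

lemma act_closed [simp]:
  assumes "\<xi> \<in> carrier K" "a \<in> carrier A" "b \<in> carrier A"
  shows "act A \<xi> a b \<in> carrier A"
  using act_hom_point [of \<xi> a] assms by (auto simp: heap_hom_def)

lemma act_tern:
  assumes "\<xi> \<in> carrier K" "p \<in> carrier A" "a \<in> carrier A" "b \<in> carrier A" "c \<in> carrier A"
  shows "act A \<xi> p \<langle>a,b,c\<rangle>\<^bsub>A\<^esub> = \<langle>act A \<xi> p a, act A \<xi> p b, act A \<xi> p c\<rangle>\<^bsub>A\<^esub>"
  using act_hom_point [of \<xi> p] assms by (auto simp: heap_hom_def)

text \<open>The base point is \<open>\<zero> \<cdot> p\<close>, and \<open>\<xi> \<otimes> \<zero> = \<zero>\<close>.\<close>

lemma act_base: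
  assumes "\<xi> \<in> carrier K" "p \<in> carrier A"
  shows "act A \<xi> p p = p"
  using act_mult [of \<xi> "\<zero>\<^bsub>K\<^esub>" p p] assms by (simp add: act_zero)

lemma act_add:
  assumes "\<xi> \<in> carrier K" "\<zeta> \<in> carrier K" "p \<in> carrier A" "b \<in> carrier A"
  shows "act A (\<xi> \<oplus>\<^bsub>K\<^esub> \<zeta>) p b = \<langle>act A \<xi> p b, p, act A \<zeta> p b\<rangle>\<^bsub>A\<^esub>"
proof -
  have "act A (\<xi> \<ominus>\<^bsub>K\<^esub> \<zero>\<^bsub>K\<^esub> \<oplus>\<^bsub>K\<^esub> \<zeta>) p b =
      \<langle>act A \<xi> p b, act A \<zero>\<^bsub>K\<^esub> p b, act A \<zeta> p b\<rangle>\<^bsub>A\<^esub>"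
    using act_hom_scalar [of p b] assms by (simp add: heap_hom_def ring_heap_def)
  moreover have "\<xi> \<ominus>\<^bsub>K\<^esub> \<zero>\<^bsub>K\<^esub> = \<xi>"
    using assms by (simp add: minus_eq)
  ultimately show ?thesis
    using assms by (simp add: act_zero)
qed

lemma fibre_simps [simp]:
  "carrier (fibre A p) = carrier A" "\<zero>\<^bsub>fibre A p\<^esub> = p"
  "a \<oplus>\<^bsub>fibre A p\<^esub> b = \<langle>a,p,b\<rangle>\<^bsub>A\<^esub>" "\<xi> \<odot>\<^bsub>fibre A p\<^esub> a = act A \<xi> p a"
  by (simp_all add: fibre_def)

lemma fibre_abelian_group:
  assumes p [simp]: "p \<in> carrier A"
  shows "abelian_group (fibre A p)"
proof (rule abelian_groupI)
  fix x assume x: "x \<in> carrier (fibre A p)"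
  have "\<langle>\<langle>p,x,p\<rangle>\<^bsub>A\<^esub>,p,x\<rangle>\<^bsub>A\<^esub> = p"
    using x by (simp add: tern_assoc tern_left_cancel tern_right_cancel)
  with x show "\<exists>y\<in>carrier (fibre A p). y \<oplus>\<^bsub>fibre A p\<^esub> x = \<zero>\<^bsub>fibre A p\<^esub>"
    by (auto intro!: bexI [where x = "\<langle>p,x,p\<rangle>\<^bsub>A\<^esub>"] tern_closed)
qed (auto simp: tern_closed tern_assoc tern_left_cancel intro: tern_commute)

lemma fibre_module:
  assumes p [simp]: "p \<in> carrier A"
  shows "module K (fibre A p)"
  by (rule moduleI)
    (auto simp: fibre_abelian_group act_add act_tern act_base act_mult act_one is_cring)

lemma tern_fibre:
  assumes p: "p \<in> carrier A" and abc: "a \<in> carrier A" "b \<in> carrier A" "c \<in> carrier A"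
  shows "\<langle>a,b,c\<rangle>\<^bsub>A\<^esub> = a \<ominus>\<^bsub>fibre A p\<^esub> b \<oplus>\<^bsub>fibre A p\<^esub> c"
proof -
  interpret V: abelian_group "fibre A p"
    by (rule fibre_abelian_group [OF p])
  have "\<ominus>\<^bsub>fibre A p\<^esub> b = \<langle>p,b,p\<rangle>\<^bsub>A\<^esub>"
    by (rule V.minus_equality)
      (use p abc in \<open>simp_all add: tern_closed tern_assoc tern_left_cancel tern_right_cancel\<close>)
  moreover have "\<langle>a,p,\<langle>p,b,c\<rangle>\<^bsub>A\<^esub>\<rangle>\<^bsub>A\<^esub> = \<langle>a,b,c\<rangle>\<^bsub>A\<^esub>"
    using p abc by (simp flip: tern_assoc add: tern_right_cancel)
  ultimately show ?thesis
    using p abc by (simp add: V.minus_eq tern_closed tern_assoc tern_left_cancel)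
qed

lemma affine_mapD:
  assumes "f \<in> affine_map K A A"
  shows affine_map_closed: "a \<in> carrier A \<Longrightarrow> f a \<in> carrier A"
    and affine_map_of_tern: "\<lbrakk>a \<in> carrier A; b \<in> carrier A; c \<in> carrier A\<rbrakk>
      \<Longrightarrow> f \<langle>a,b,c\<rangle>\<^bsub>A\<^esub> = \<langle>f a, f b, f c\<rangle>\<^bsub>A\<^esub>"
    and affine_map_of_act: "\<lbrakk>\<xi> \<in> carrier K; a \<in> carrier A; b \<in> carrier A\<rbrakk>
      \<Longrightarrow> f (act A \<xi> a b) = act A \<xi> (f a) (f b)"
  using assms by (auto simp: affine_map_def heap_hom_def)

lemma affine_map_ident: "(\<lambda>x. x) \<in> affine_map K A A"
  by (simp add: affine_map_def heap_hom_def)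

lemma affine_map_const:
  assumes "c \<in> carrier A"
  shows "(\<lambda>_. c) \<in> affine_map K A A"
  using assms by (simp add: affine_map_def heap_hom_def tern_left_cancel act_base)

text \<open>
  The heap operation is affine in its three arguments jointly. For scalars, moving every action to
  one common base point turns this into the medial law.
\<close>

lemma act_tern_tern:
  assumes [simp]: "\<xi> \<in> carrier K" "a \<in> carrier A" "b \<in> carrier A" "c \<in> carrier A"
    "x \<in> carrier A" "y \<in> carrier A" "z \<in> carrier A"
  shows "act A \<xi> \<langle>a,b,c\<rangle>\<^bsub>A\<^esub> \<langle>x,y,z\<rangle>\<^bsub>A\<^esub> = \<langle>act A \<xi> a x, act A \<xi> b y, act A \<xi> c z\<rangle>\<^bsub>A\<^esub>"
proof -
  have "act A \<xi> \<langle>a,b,c\<rangle>\<^bsub>A\<^esub> \<langle>x,y,z\<rangle>\<^bsub>A\<^esub> =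
      \<langle>\<langle>act A \<xi> a x, act A \<xi> a y, act A \<xi> a z\<rangle>\<^bsub>A\<^esub>,
        \<langle>act A \<xi> a a, act A \<xi> a b, act A \<xi> a c\<rangle>\<^bsub>A\<^esub>, \<langle>a,b,c\<rangle>\<^bsub>A\<^esub>\<rangle>\<^bsub>A\<^esub>"
    by (subst act_base_change [where c = a]) (simp_all add: tern_closed act_tern)
  also have "\<dots> = \<langle>\<langle>act A \<xi> a x, act A \<xi> a a, a\<rangle>\<^bsub>A\<^esub>,
        \<langle>act A \<xi> a y, act A \<xi> a b, b\<rangle>\<^bsub>A\<^esub>, \<langle>act A \<xi> a z, act A \<xi> a c, c\<rangle>\<^bsub>A\<^esub>\<rangle>\<^bsub>A\<^esub>"
    by (rule tern_medial) simp_all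
  also have "\<dots> = \<langle>act A \<xi> a x, act A \<xi> b y, act A \<xi> c z\<rangle>\<^bsub>A\<^esub>"
    by (simp flip: act_base_change)
  finally show ?thesis .
qed

lemma affine_map_tern:
  assumes "f \<in> affine_map K A A" "g \<in> affine_map K A A" "h \<in> affine_map K A A"
  shows "(\<lambda>x. \<langle>f x, g x, h x\<rangle>\<^bsub>A\<^esub>) \<in> affine_map K A A"
  unfolding affine_map_def heap_hom_def
  by (auto simp: assms [THEN affine_map_closed] assms [THEN affine_map_of_tern]
      assms [THEN affine_map_of_act] tern_closed act_tern_tern intro: tern_medial)

lemma affine_map_tern5:
  assumes "f \<in> affine_map K A A" "g \<in> affine_map K A A" "h \<in> affine_map K A A"
    "i \<in> affine_map K A A" "j \<in> affine_map K A A"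
  shows "(\<lambda>x. tern5 A (f x) (g x) (h x) (i x) (j x)) \<in> affine_map K A A"
  unfolding tern5_def using assms by (intro affine_map_tern)

lemma affine_map_linear:
  assumes "f \<in> affine_map K A A" "p \<in> carrier A" "f p = q"
  shows "f \<in> linear_map K (fibre A p) (fibre A q)"
  using assms(2,3)
  by (auto simp: linear_map_def affine_map_closed [OF assms(1)] affine_map_of_tern [OF assms(1)]
      affine_map_of_act [OF assms(1)])

text \<open>Translations form a group, so the translation from \<open>e\<close> back to \<open>p\<close> is the inverse.\<close>

lemma translation_bij:
  assumes [simp]: "p \<in> carrier A" "e \<in> carrier A"
  shows "bij_betw (\<lambda>x. \<langle>x,p,e\<rangle>\<^bsub>A\<^esub>) (carrier A) (carrier A)"
  by (rule bij_betwI [where g = "\<lambda>x. \<langle>x,e,p\<rangle>\<^bsub>A\<^esub>"])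
    (auto simp: tern_closed tern_assoc tern_left_cancel tern_right_cancel)

end


section \<open>The bilinear part of a bi-affine product\<close>

context hom_assoc_affgebra
begin

lemma left_affine: "w \<in> carrier A \<Longrightarrow> (\<lambda>z. m w z) \<in> affine_map K A A"
  and right_affine: "z \<in> carrier A \<Longrightarrow> (\<lambda>w. m w z) \<in> affine_map K A A"
  using mult_bi_affine by (auto simp: bi_affine_def)

lemma mult_closed [simp]: "\<lbrakk>w \<in> carrier A; z \<in> carrier A\<rbrakk> \<Longrightarrow> m w z \<in> carrier A"
  using left_affine affine_map_closed by blast

lemma twist_closed [simp]: "a \<in> carrier A \<Longrightarrow> \<alpha> a \<in> carrier A"
  using twist_affine affine_map_closed by blast

lemma fibre_mult_bilinear:
  assumes p [simp]: "p \<in> carrier A"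
  shows "bilinear_product K (fibre A p) (fibre_mult A m p)"
  unfolding bilinear_product_def fibre_simps
proof (intro conjI ballI)
  fix x assume x [simp]: "x \<in> carrier A"
  show "(\<lambda>y. fibre_mult A m p x y) \<in> linear_map K (fibre A p) (fibre A p)"
  proof (rule affine_map_linear)
    show "(\<lambda>y. fibre_mult A m p x y) \<in> affine_map K A A"
      unfolding fibre_mult_def
      by (intro affine_map_tern5 left_affine affine_map_const) simp_all
  qed (simp_all add: fibre_mult_def tern5_def tern_left_cancel tern_right_cancel)
  show "(\<lambda>y. fibre_mult A m p y x) \<in> linear_map K (fibre A p) (fibre A p)"
  proof (rule affine_map_linear)
    show "(\<lambda>y. fibre_mult A m p y x) \<in> affine_map K A A"
      unfolding fibre_mult_def
      by (intro affine_map_tern5 right_affine affine_map_const) simp_all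
  qed (simp_all add: fibre_mult_def tern5_def tern_left_cancel tern_right_cancel)
qed

definition left_linear_part :: "'a \<Rightarrow> 'a \<Rightarrow> 'a \<Rightarrow> 'a"
  where "left_linear_part p w z = \<langle>m w z, m w p, p\<rangle>\<^bsub>A\<^esub>"

lemma left_linear_part_closed [simp]:
  "\<lbrakk>p \<in> carrier A; w \<in> carrier A; z \<in> carrier A\<rbrakk> \<Longrightarrow> left_linear_part p w z \<in> carrier A"
  by (simp add: left_linear_part_def tern_closed)

lemma left_linear_part_base:
  "\<lbrakk>p \<in> carrier A; w \<in> carrier A\<rbrakk> \<Longrightarrow> left_linear_part p w p = p"
  by (simp add: left_linear_part_def tern_left_cancel)

lemma left_linear_part_tern_right:
  assumes "p \<in> carrier A" "w \<in> carrier A" "x \<in> carrier A" "y \<in> carrier A" "z \<in> carrier A"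
  shows "left_linear_part p w \<langle>x,y,z\<rangle>\<^bsub>A\<^esub> =
    \<langle>left_linear_part p w x, left_linear_part p w y, left_linear_part p w z\<rangle>\<^bsub>A\<^esub>"
proof -
  have "(\<lambda>z. left_linear_part p w z) \<in> affine_map K A A"
    unfolding left_linear_part_def
    using assms by (intro affine_map_tern left_affine affine_map_const) simp_all
  from affine_map_of_tern [OF this] show ?thesis using assms by simp
qed

lemma left_linear_part_tern_left:
  assumes "p \<in> carrier A" "z \<in> carrier A" "w \<in> carrier A" "x \<in> carrier A" "y \<in> carrier A"
  shows "left_linear_part p \<langle>w,x,y\<rangle>\<^bsub>A\<^esub> z =
    \<langle>left_linear_part p w z, left_linear_part p x z, left_linear_part p y z\<rangle>\<^bsub>A\<^esub>"
proof -
  have "(\<lambda>w. left_linear_part p w z) \<in> affine_map K A A"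
    unfolding left_linear_part_def
    using assms by (intro affine_map_tern right_affine affine_map_const) simp_all
  from affine_map_of_tern [OF this] show ?thesis using assms by simp
qed

text \<open>
  The difference \<open>(x \<bullet> y - x \<bullet> p) - (p \<bullet> y - p \<bullet> p)\<close>: the product \<open>\<bullet>\<^sub>p\<close> is the linear part
  in \<open>x\<close> of the linear part in \<open>y\<close>.
\<close>

lemma fibre_mult_eq:
  assumes [simp]: "p \<in> carrier A" "x \<in> carrier A" "y \<in> carrier A"
  shows "fibre_mult A m p x y = \<langle>left_linear_part p x y, left_linear_part p p y, p\<rangle>\<^bsub>A\<^esub>"
proof -
  have "\<langle>left_linear_part p x y, left_linear_part p p y, p\<rangle>\<^bsub>A\<^esub> =
      \<langle>\<langle>\<langle>m x y, m x p, p\<rangle>\<^bsub>A\<^esub>, p, m p p\<rangle>\<^bsub>A\<^esub>, m p y, p\<rangle>\<^bsub>A\<^esub>"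
    by (simp add: left_linear_part_def tern_middle tern_closed)
  also have "\<langle>\<langle>m x y, m x p, p\<rangle>\<^bsub>A\<^esub>, p, m p p\<rangle>\<^bsub>A\<^esub> = \<langle>m x y, m x p, m p p\<rangle>\<^bsub>A\<^esub>"
    by (simp add: tern_assoc tern_left_cancel)
  finally show ?thesis by (simp add: fibre_mult_def tern5_def)
qed


section \<open>Hom-associativity of the fibre product\<close>

text \<open>
  Subtracting the Hom-associative law at \<open>z = p\<close> from the law at \<open>z\<close>. The outer linear part carries
  both terms of \<open>y \<bullet> z - y \<bullet> p\<close> to products with \<open>\<alpha> x\<close>, up to the constant \<open>\<alpha> x \<bullet> p\<close>, which
  cancels in the difference.
\<close>

lemma left_linear_part_hom_assoc:
  assumes p [simp]: "p \<in> carrier A" and fixed: "\<alpha> p = p"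
    and [simp]: "x \<in> carrier A" "y \<in> carrier A" "z \<in> carrier A"
  shows "left_linear_part p (\<alpha> x) (left_linear_part p y z) = left_linear_part p (m x y) (\<alpha> z)"
proof -
  have "left_linear_part p (\<alpha> x) (left_linear_part p y z) =
      \<langle>left_linear_part p (\<alpha> x) (m y z), left_linear_part p (\<alpha> x) (m y p), p\<rangle>\<^bsub>A\<^esub>"
    by (subst (2) left_linear_part_def)
      (simp add: left_linear_part_tern_right left_linear_part_base)
  also have "\<dots> = \<langle>\<langle>\<langle>m (\<alpha> x) (m y z), m (\<alpha> x) p, p\<rangle>\<^bsub>A\<^esub>, p, m (\<alpha> x) p\<rangle>\<^bsub>A\<^esub>,
      m (\<alpha> x) (m y p), p\<rangle>\<^bsub>A\<^esub>"
    by (simp add: left_linear_part_def tern_middle tern_closed)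
  also have "\<langle>\<langle>m (\<alpha> x) (m y z), m (\<alpha> x) p, p\<rangle>\<^bsub>A\<^esub>, p, m (\<alpha> x) p\<rangle>\<^bsub>A\<^esub> = m (\<alpha> x) (m y z)"
    by (simp add: tern_assoc tern_left_cancel tern_right_cancel)
  also have "\<langle>m (\<alpha> x) (m y z), m (\<alpha> x) (m y p), p\<rangle>\<^bsub>A\<^esub> = left_linear_part p (m x y) (\<alpha> z)"
    by (simp add: left_linear_part_def hom_assoc fixed)
  finally show ?thesis .
qed

text \<open>
  Expanding \<open>\<alpha> x \<bullet>\<^sub>p (y \<bullet>\<^sub>p z)\<close> in \<open>x\<close> and \<open>y\<close> gives four composites of linear parts; each is a
  linear part at one of \<open>x \<bullet> y\<close>, \<open>x \<bullet> p\<close>, \<open>p \<bullet> p\<close>, \<open>p \<bullet> y\<close>, evaluated at \<open>\<alpha> z\<close>. Since linear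
  parts depend on the left factor affinely, they collect into the linear part at \<open>x \<bullet>\<^sub>p y\<close>.
\<close>

lemma fibre_mult_hom_assoc:
  assumes p [simp]: "p \<in> carrier A" and fixed: "\<alpha> p = p"
    and [simp]: "x \<in> carrier A" "y \<in> carrier A" "z \<in> carrier A"
  shows "fibre_mult A m p (\<alpha> x) (fibre_mult A m p y z) =
    fibre_mult A m p (fibre_mult A m p x y) (\<alpha> z)"
proof -
  define L where "L w = left_linear_part p w (\<alpha> z)" for w
  have L [simp]: "L w \<in> carrier A" if "w \<in> carrier A" for w
    using that by (simp add: L_def)
  have comp: "left_linear_part p (\<alpha> u) (left_linear_part p v z) = L (m u v)"
    if "u \<in> carrier A" "v \<in> carrier A" for u v
    using that fixed by (simp add: L_def left_linear_part_hom_assoc)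
  have B: "fibre_mult A m p u v \<in> carrier A" if "u \<in> carrier A" "v \<in> carrier A" for u v
    using that by (simp add: fibre_mult_eq tern_closed)
  have inner: "left_linear_part p (\<alpha> u) (fibre_mult A m p y z) = \<langle>L (m u y), L (m u p), p\<rangle>\<^bsub>A\<^esub>"
    if "u \<in> carrier A" for u
    using that by (simp add: fibre_mult_eq left_linear_part_tern_right left_linear_part_base comp)
  have "fibre_mult A m p (\<alpha> x) (fibre_mult A m p y z) =
      \<langle>left_linear_part p (\<alpha> x) (fibre_mult A m p y z),
        left_linear_part p (\<alpha> p) (fibre_mult A m p y z), p\<rangle>\<^bsub>A\<^esub>"
    by (simp add: fibre_mult_eq [of p "\<alpha> x"] B fixed)
  also have "\<dots> = \<langle>\<langle>L (m x y), L (m x p), p\<rangle>\<^bsub>A\<^esub>, \<langle>L (m p y), L (m p p), p\<rangle>\<^bsub>A\<^esub>, p\<rangle>\<^bsub>A\<^esub>"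
    by (simp only: inner p \<open>x \<in> carrier A\<close>)
  also have "\<dots> = \<langle>\<langle>\<langle>L (m x y), L (m x p), p\<rangle>\<^bsub>A\<^esub>, p, L (m p p)\<rangle>\<^bsub>A\<^esub>, L (m p y), p\<rangle>\<^bsub>A\<^esub>"
    by (simp add: tern_middle tern_closed)
  also have "\<dots> = \<langle>\<langle>L (m x y), L (m x p), L (m p p)\<rangle>\<^bsub>A\<^esub>, L (m p y), p\<rangle>\<^bsub>A\<^esub>"
    by (simp add: tern_assoc [where b = "L (m x p)"] tern_left_cancel)
  \<comment> \<open>Inserting \<open>L p\<close> completes the image under \<open>L\<close> of the five entries of \<open>x \<bullet>\<^sub>p y\<close>.\<close>
  also have "\<dots> = \<langle>\<langle>\<langle>L (m x y), L (m x p), L (m p p)\<rangle>\<^bsub>A\<^esub>, L (m p y), L p\<rangle>\<^bsub>A\<^esub>, L p, p\<rangle>\<^bsub>A\<^esub>"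
    by (simp add: tern_assoc tern_closed tern_left_cancel)
  also have "\<dots> = \<langle>L (fibre_mult A m p x y), L p, p\<rangle>\<^bsub>A\<^esub>"
    by (simp add: fibre_mult_def tern5_def L_def left_linear_part_tern_left tern_closed)
  also have "\<dots> = fibre_mult A m p (fibre_mult A m p x y) (\<alpha> z)"
    by (simp add: fibre_mult_eq [of p "fibre_mult A m p x y"] B L_def)
  finally show ?thesis .
qed

lemma fibre_hom_assoc_algebra:
  assumes "p \<in> carrier A" "\<alpha> p = p"
  shows "hom_assoc_algebra K (fibre A p) (fibre_mult A m p) \<alpha>"
proof -
  interpret V: module K "fibre A p"
    using assms(1) by (rule fibre_module)
  show ?thesis
    using assms
    by unfold_locales
      (simp_all add: fibre_mult_bilinear affine_map_linear twist_affine fibre_mult_hom_assoc)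
qed

lemma fibre_mult_sum:
  assumes p [simp]: "p \<in> carrier A" and [simp]: "a \<in> carrier A" "b \<in> carrier A"
  shows "fibre_mult A m p a b =
    m a b \<ominus>\<^bsub>fibre A p\<^esub> m a p \<oplus>\<^bsub>fibre A p\<^esub> m p p \<ominus>\<^bsub>fibre A p\<^esub> m p b \<oplus>\<^bsub>fibre A p\<^esub> p"
proof -
  have "fibre_mult A m p a b =
      \<langle>m a b, m a p, m p p\<rangle>\<^bsub>A\<^esub> \<ominus>\<^bsub>fibre A p\<^esub> m p b \<oplus>\<^bsub>fibre A p\<^esub> p"
    unfolding fibre_mult_def tern5_def by (rule tern_fibre) (simp_all add: tern_closed)
  then show ?thesis
    by (simp only: tern_fibre [of p "m a b" "m a p" "m p p"] mult_closed assms)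
qed


section \<open>Change of base point\<close>

text \<open>
  Differences \<open>w \<bullet> z - w \<bullet> p\<close> do not change when both right-hand factors are translated.
\<close>

lemma left_linear_part_translation:
  assumes [simp]: "p \<in> carrier A" "e \<in> carrier A" "w \<in> carrier A" "z \<in> carrier A"
  shows "left_linear_part e w \<langle>z,p,e\<rangle>\<^bsub>A\<^esub> = \<langle>left_linear_part p w z, p, e\<rangle>\<^bsub>A\<^esub>"
  by (simp add: left_linear_part_def affine_map_of_tern [OF left_affine] tern_assoc tern_closed
      tern_left_cancel)

text \<open>The same invariance, applied once in each factor.\<close>

lemma fibre_mult_translation:
  assumes [simp]: "p \<in> carrier A" "e \<in> carrier A" "x \<in> carrier A" "y \<in> carrier A"
  shows "fibre_mult A m e \<langle>x,p,e\<rangle>\<^bsub>A\<^esub> \<langle>y,p,e\<rangle>\<^bsub>A\<^esub> = \<langle>fibre_mult A m p x y, p, e\<rangle>\<^bsub>A\<^esub>"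
proof -
  have "fibre_mult A m e \<langle>x,p,e\<rangle>\<^bsub>A\<^esub> \<langle>y,p,e\<rangle>\<^bsub>A\<^esub> =
      \<langle>left_linear_part e x \<langle>y,p,e\<rangle>\<^bsub>A\<^esub>, left_linear_part e p \<langle>y,p,e\<rangle>\<^bsub>A\<^esub>, e\<rangle>\<^bsub>A\<^esub>"
    by (simp add: fibre_mult_eq left_linear_part_tern_left tern_closed tern_assoc tern_left_cancel)
  also have "\<dots> = \<langle>\<langle>left_linear_part p x y, p, e\<rangle>\<^bsub>A\<^esub>, \<langle>left_linear_part p p y, p, e\<rangle>\<^bsub>A\<^esub>,
      \<langle>p,p,e\<rangle>\<^bsub>A\<^esub>\<rangle>\<^bsub>A\<^esub>"
    by (simp add: left_linear_part_translation tern_left_cancel)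
  also have "\<dots> = \<langle>\<langle>left_linear_part p x y, left_linear_part p p y, p\<rangle>\<^bsub>A\<^esub>, \<langle>p,p,p\<rangle>\<^bsub>A\<^esub>,
      \<langle>e,e,e\<rangle>\<^bsub>A\<^esub>\<rangle>\<^bsub>A\<^esub>"
    by (rule tern_medial) simp_all
  finally show ?thesis by (simp add: fibre_mult_eq tern_left_cancel)
qed

lemma translation_hom_assoc_algebra_iso:
  assumes p [simp]: "p \<in> carrier A" "\<alpha> p = p" and e [simp]: "e \<in> carrier A" "\<alpha> e = e"
  shows "(\<lambda>x. \<langle>x,p,e\<rangle>\<^bsub>A\<^esub>) \<in> hom_assoc_algebra_iso K (fibre A p) (fibre_mult A m p) \<alpha>
    (fibre A e) (fibre_mult A m e) \<alpha>"
proof -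
  have "(\<lambda>x. \<langle>x,p,e\<rangle>\<^bsub>A\<^esub>) \<in> affine_map K A A"
    by (intro affine_map_tern affine_map_ident affine_map_const p e)
  then have "(\<lambda>x. \<langle>x,p,e\<rangle>\<^bsub>A\<^esub>) \<in> linear_map K (fibre A p) (fibre A e)"
    by (rule affine_map_linear) (simp_all add: tern_left_cancel)
  then show ?thesis
    by (simp add: hom_assoc_algebra_iso_def translation_bij fibre_mult_translation
        affine_map_of_tern [OF twist_affine])
qed

end


section \<open>The fibre algebras of a Hom-associative affgebra\<close>

theorem theorem5p2:
  fixes K :: "('k, 'y) ring_scheme" and A :: "('k, 'a, 'z) affine_scheme"
    and m :: "'a \<Rightarrow> 'a \<Rightarrow> 'a" and \<alpha> :: "'a \<Rightarrow> 'a"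
  assumes "field K"
    and "ring_characteristic K \<noteq> 2"
    and "multiplicative_hom_assoc_affgebra K A m \<alpha>"
  shows "(\<forall>p\<in>carrier A. \<alpha> p = p \<longrightarrow>
      hom_assoc_algebra K (fibre A p) (fibre_mult A m p) \<alpha> \<and>
      (\<forall>a\<in>carrier (fibre A p). \<forall>b\<in>carrier (fibre A p).
        fibre_mult A m p a b =
          m a b \<ominus>\<^bsub>fibre A p\<^esub> m a p \<oplus>\<^bsub>fibre A p\<^esub> m p p
            \<ominus>\<^bsub>fibre A p\<^esub> m p b \<oplus>\<^bsub>fibre A p\<^esub> p)) \<and>
    (\<forall>p\<in>carrier A. \<forall>e\<in>carrier A. \<alpha> p = p \<longrightarrow> \<alpha> e = e \<longrightarrow>
      hom_assoc_algebra_iso K (fibre A p) (fibre_mult A m p) \<alpha>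
        (fibre A e) (fibre_mult A m e) \<alpha> \<noteq> {})"
proof -
  interpret multiplicative_hom_assoc_affgebra K A m \<alpha>
    by (rule assms(3))
  show ?thesis
    using fibre_hom_assoc_algebra fibre_mult_sum translation_hom_assoc_algebra_iso
    by (fastforce simp del: fibre_simps(2-4))
qed

end
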